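(* Let $M$ be a submonoid of $\mathbb{Z}^m$ with a monoid homomorphism $\deg:M\to\mathbb{N}$ such that $\{\lambda\in M:\deg\lambda\le d\}$ is finite for every $d\in\mathbb{R}$, let $J$ be a subset of $M$, and let $R$ be an integral domain. Suppose that there is a collection $\{\delta_\alpha\in\mathrm{Hom}_{\mathbb{Z}}(\mathbb{Z}^m,\mathbb{R}):\alpha\in A\}$ of $\mathbb{Z}$-linear functions $\delta_\alpha:\mathbb{Z}^m\to\mathbb{R}$ satisfying: (i) for every $\alpha\in A$ the minimum $\varepsilon_\alpha=\min_{D\in J}\delta_\alpha(D)$ exists and $\varepsilon_\alpha\ge0$; (ii) $\{J_\alpha:\alpha\in A\}$ is an infinite set, where $J_\alpha=\{D\in J:\delta_\alpha(D)=\varepsilon_\alpha\}$ for $\alpha\in A$. Then the series $$f(t)=\sum_{D\in J}a_Dt^D\in R[[M]]$$ is transcendental as long as $a_D\ne0$ for every $D\in J$.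
   Context: $R[[M]]$ is the ring of all functions $M\to R$, written as formal sums $\sum_{\lambda\in M}a_\lambda t^\lambda$ with $a_\lambda\in R$, with convolution product $t^\lambda t^\mu=t^{\lambda+\mu}$ (well defined because of the finiteness condition on $\deg$). $R[M]\subset R[[M]]$ is the subring of finite sums. An element $f\in R[[M]]$ is algebraic if there exist $a_0,\dots,a_d\in R[M]$, not all zero, with $a_0+a_1f+\cdots+a_df^d=0$; otherwise $f$ is transcendental. *)

theory Defs
  imports "HOL-Analysis.Finite_Cartesian_Product" "HOL-Algebra.Ring"
begin

text \<open>
  The ring R[[M]] for a submonoid M of \<open>\<int>\<^sup>m\<close>.  A function from M to R is represented by its
  extension by zero to all of \<open>\<int>\<^sup>m\<close>.  The convolution sum ranges over a finite set, and the
  record is a commutative ring, when M carries a degree with finite sublevel sets: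
  see \<open>finite_series_splits\<close> and \<open>cring_monoid_series\<close>.
\<close>

definition series_splits :: "(int ^ 'm::finite) set \<Rightarrow> int ^ 'm \<Rightarrow> ((int ^ 'm) \<times> (int ^ 'm)) set" where
  "series_splits M \<nu> = {(\<kappa>, \<mu>). \<kappa> \<in> M \<and> \<mu> \<in> M \<and> \<kappa> + \<mu> = \<nu>}"

definition monoid_series :: "(int ^ 'm::finite) set \<Rightarrow> (int ^ 'm \<Rightarrow> 'r::idom) ring" where
  "monoid_series M =
    \<lparr>carrier = {f. \<forall>\<kappa>. \<kappa> \<notin> M \<longrightarrow> f \<kappa> = 0},
     monoid.mult = (\<lambda>f g \<nu>. \<Sum>(\<kappa>, \<mu>)\<in>series_splits M \<nu>. f \<kappa> * g \<mu>),
     one = (\<lambda>\<nu>. if \<nu> = 0 then 1 else 0),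
     zero = (\<lambda>\<nu>. 0),
     add = (\<lambda>f g \<nu>. f \<nu> + g \<nu>)\<rparr>"

text \<open>The subring R[M] of finite sums.\<close>

definition monoid_polys :: "(int ^ 'm::finite) set \<Rightarrow> (int ^ 'm \<Rightarrow> 'r::idom) set" where
  "monoid_polys M = {f \<in> carrier (monoid_series M). finite {\<kappa>. f \<kappa> \<noteq> 0}}"

definition algebraic_series :: "(int ^ 'm::finite) set \<Rightarrow> (int ^ 'm \<Rightarrow> 'r::idom) \<Rightarrow> bool" where
  "algebraic_series M f \<longleftrightarrow>
    f \<in> carrier (monoid_series M) \<and>
    (\<exists>(d::nat) a.
      (\<forall>i\<le>d. a i \<in> monoid_polys M) \<and>
      (\<exists>i\<le>d. a i \<noteq> \<zero>\<^bsub>monoid_series M\<^esub>) \<and>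
      (\<Oplus>\<^bsub>monoid_series M\<^esub>i\<in>{..d}. a i \<otimes>\<^bsub>monoid_series M\<^esub> (f [^]\<^bsub>monoid_series M\<^esub> i))
        = \<zero>\<^bsub>monoid_series M\<^esub>)"

definition transcendental_series :: "(int ^ 'm::finite) set \<Rightarrow> (int ^ 'm \<Rightarrow> 'r::idom) \<Rightarrow> bool" where
  "transcendental_series M f \<longleftrightarrow> f \<in> carrier (monoid_series M) \<and> \<not> algebraic_series M f"

lemma finite_series_splits:
  fixes M :: "(int ^ 'm::finite) set" and deg :: "int ^ 'm \<Rightarrow> nat"
  assumes add: "\<And>\<kappa> \<mu>. \<kappa> \<in> M \<Longrightarrow> \<mu> \<in> M \<Longrightarrow> deg (\<kappa> + \<mu>) = deg \<kappa> + deg \<mu>"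
    and fin: "\<And>d::real. finite {\<kappa> \<in> M. real (deg \<kappa>) \<le> d}"
  shows "finite (series_splits M \<nu>)"
proof (rule finite_subset)
  let ?S = "{\<kappa> \<in> M. real (deg \<kappa>) \<le> real (deg \<nu>)}"
  show "series_splits M \<nu> \<subseteq> ?S \<times> ?S"
    by (auto simp: series_splits_def add)
  show "finite (?S \<times> ?S)"
    using fin by blast
qed

lemma cring_monoid_series:
  fixes M :: "(int ^ 'm::finite) set" and deg :: "int ^ 'm \<Rightarrow> nat"
  assumes zero: "0 \<in> M"
    and closed: "\<And>\<kappa> \<mu>. \<kappa> \<in> M \<Longrightarrow> \<mu> \<in> M \<Longrightarrow> \<kappa> + \<mu> \<in> M"
    and add: "\<And>\<kappa> \<mu>. \<kappa> \<in> M \<Longrightarrow> \<mu> \<in> M \<Longrightarrow> deg (\<kappa> + \<mu>) = deg \<kappa> + deg \<mu>"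
    and fin: "\<And>d::real. finite {\<kappa> \<in> M. real (deg \<kappa>) \<le> d}"
  shows "cring (monoid_series M :: (int ^ 'm \<Rightarrow> 'r::idom) ring)"
proof -
  have finS [simp]: "finite (series_splits M \<nu>)" for \<nu>
    by (rule finite_series_splits [OF add fin])
  have comm: "(\<Sum>(\<kappa>, \<mu>)\<in>series_splits M \<nu>. f \<kappa> * g \<mu>) = (\<Sum>(\<kappa>, \<mu>)\<in>series_splits M \<nu>. g \<kappa> * f \<mu>)"
    for f g :: "int ^ 'm \<Rightarrow> 'r" and \<nu>
    by (rule sum.reindex_bij_witness [where i = prod.swap and j = prod.swap])
      (auto simp: series_splits_def ac_simps)
  have assoc: "(\<Sum>(\<kappa>, \<mu>)\<in>series_splits M \<nu>. (\<Sum>(\<alpha>, \<beta>)\<in>series_splits M \<kappa>. f \<alpha> * g \<beta>) * h \<mu>) =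
      (\<Sum>(\<kappa>, \<mu>)\<in>series_splits M \<nu>. f \<kappa> * (\<Sum>(\<alpha>, \<beta>)\<in>series_splits M \<mu>. g \<alpha> * h \<beta>))" (is "?L = ?R")
    for f g h :: "int ^ 'm \<Rightarrow> 'r" and \<nu>
  proof -
    have "?L = (\<Sum>(p, q)\<in>(SIGMA p:series_splits M \<nu>. series_splits M (fst p)).
        f (fst q) * g (snd q) * h (snd p))"
      by (subst sum.Sigma [symmetric]) (auto simp: sum_distrib_right case_prod_unfold)
    also have "\<dots> = (\<Sum>(p, q)\<in>(SIGMA p:series_splits M \<nu>. series_splits M (snd p)).
        f (fst p) * (g (fst q) * h (snd q)))"
      by (rule sum.reindex_bij_witness
          [where j = "\<lambda>(p, q). ((fst q, snd q + snd p), (snd q, snd p))"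
            and i = "\<lambda>(p, q). ((fst p + fst q, snd q), (fst p, fst q))"])
        (auto simp: series_splits_def ac_simps closed)
    also have "\<dots> = ?R"
      by (subst sum.Sigma [symmetric]) (auto simp: sum_distrib_left case_prod_unfold)
    finally show ?thesis .
  qed
  have nil: "series_splits M \<nu> = {}" if "\<nu> \<notin> M" for \<nu>
    using that closed by (auto simp: series_splits_def)
  have one: "(\<Sum>(\<kappa>, \<mu>)\<in>series_splits M \<nu>. (if \<kappa> = 0 then 1 else 0) * f \<mu>) = f \<nu>"
    if f: "\<forall>\<kappa>. \<kappa> \<notin> M \<longrightarrow> f \<kappa> = 0" for f :: "int ^ 'm \<Rightarrow> 'r" and \<nu>
  proof (cases "\<nu> \<in> M")
    case True
    have "(\<Sum>(\<kappa>, \<mu>)\<in>series_splits M \<nu>. (if \<kappa> = 0 then 1 else 0) * f \<mu>) =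
        (\<Sum>p\<in>{(0 :: int ^ 'm, \<nu>)}. f (snd p))"
      using True zero
      by (intro sum.mono_neutral_cong_right finS) (auto simp: series_splits_def split: if_splits)
    then show ?thesis
      by simp
  next
    case False
    then show ?thesis
      using f by (simp add: nil)
  qed
  let ?S = "monoid_series M :: (int ^ 'm \<Rightarrow> 'r) ring"
  show ?thesis
  proof (rule cringI)
    show "abelian_group ?S"
    proof (rule abelian_groupI)
      fix f assume "f \<in> carrier ?S"
      then show "\<exists>g\<in>carrier ?S. g \<oplus>\<^bsub>?S\<^esub> f = \<zero>\<^bsub>?S\<^esub>"
        by (intro bexI [of _ "\<lambda>\<nu>. - f \<nu>"]) (auto simp: monoid_series_def)
    qed (auto simp: monoid_series_def ac_simps)
    show "comm_monoid ?S"
      by (rule comm_monoidI)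
        (use zero in \<open>auto simp: monoid_series_def nil assoc one intro: comm\<close>)
  qed (auto simp: monoid_series_def distrib_right sum.distrib case_prod_unfold)
qed

end

theory Submission
  imports Defs "HOL-Algebra.Polynomial_Divisibility"
begin

text \<open>
  Suppose that \<open>f\<close> is a root of a nonzero polynomial \<open>\<Sum>i\<le>d. b\<^sub>i x\<^sup>i\<close> with coefficients in \<open>R[M]\<close>.
  A linear functional \<open>\<delta>\<close> grades the monomials.  If \<open>\<delta>\<close> is bounded below by \<open>\<epsilon>\<close> on the support of
  \<open>f\<close>, let \<open>f\<^sub>\<delta>\<close> be the part of \<open>f\<close> on which \<open>\<delta> = \<epsilon>\<close>; then \<open>f\<^sub>\<delta>\<^sup>i\<close> is the part of \<open>f\<^sup>i\<close> of
  \<open>\<delta>\<close>-weight \<open>i \<epsilon>\<close>, the lowest weight that can occur.  Taking the part of lowest possible weight in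
  \<open>\<Sum>i\<le>d. b\<^sub>i f\<^sup>i = 0\<close> therefore gives \<open>\<Sum>i\<le>d. b'\<^sub>i f\<^sub>\<delta>\<^sup>i = 0\<close>, where each \<open>b'\<^sub>i\<close> is the restriction of \<open>b\<^sub>i\<close>
  to some subset of its support and not all \<open>b'\<^sub>i\<close> vanish (\<open>slice_is_root\<close>).

  Since the \<open>b\<^sub>i\<close> have finite support, only finitely many tuples \<open>(b'\<^sub>i)\<close> arise as \<open>\<delta>\<close> varies.  The ring
  \<open>R[[M]]\<close> is a domain (\<open>domain_monoid_series\<close>), so each of these finitely many nonzero polynomials
  has finitely many roots, and an algebraic \<open>f\<close> has only finitely many lowest parts \<open>f\<^sub>\<delta>\<close>
  (\<open>finite_lowest_slices_of_algebraic\<close>).  For the series of the theorem the support of \<open>f\<^sub>\<delta>\<close>, with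
  \<open>\<delta> = \<delta>\<^sub>\<alpha>\<close>, is the face \<open>J\<^sub>\<alpha>\<close>, because no coefficient on \<open>J\<close> vanishes.  Infinitely many faces
  thus give infinitely many lowest parts.
\<close>

section \<open>Roots of polynomials over a domain\<close>

text \<open>
  A polynomial is encoded as a list with the leading coefficient first, whence the reversal.
\<close>

lemma (in ring) eval_rev_map_upt:
  assumes "\<And>i. i < n \<Longrightarrow> c i \<in> carrier R" and "x \<in> carrier R"
  shows "eval (rev (map c [0..<n])) x = (\<Oplus>i\<in>{..<n}. c i \<otimes> x [^] i)"
  using assms
proof (induction n)
  case (Suc n)
  have "(\<Oplus>i\<in>{..<Suc n}. c i \<otimes> x [^] i) = c n \<otimes> x [^] n \<oplus> (\<Oplus>i\<in>{..<n}. c i \<otimes> x [^] i)"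
    unfolding lessThan_Suc using Suc.prems by (subst finsum_insert) auto
  then show ?case
    using Suc by simp
qed simp

lemma (in domain) finite_roots_of_power_sum:
  fixes d :: nat
  assumes c: "\<And>i. i \<le> d \<Longrightarrow> c i \<in> carrier R" and nonzero: "\<exists>i\<le>d. c i \<noteq> \<zero>"
  shows "finite {x \<in> carrier R. (\<Oplus>i\<in>{..d}. c i \<otimes> x [^] i) = \<zero>}"
proof -
  define p where "p = rev (map c [0..<Suc d])"
  have p: "set p \<subseteq> carrier R"
    using c by (auto simp: p_def less_Suc_eq_le)
  \<comment> \<open>The coefficients at the top may vanish, so only the normalized list is a polynomial.\<close>
  have "normalize p \<noteq> []"
  proof
    assume "normalize p = []"
    then have "\<forall>y\<in>set p. y = \<zero>"
      using normalize_def'[of p] by (metis append_Nil2 in_set_replicate)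
    then show False
      using nonzero by (force simp: p_def)
  qed
  moreover have "eval (normalize p) x = (\<Oplus>i\<in>{..d}. c i \<otimes> x [^] i)" if "x \<in> carrier R" for x
    using eval_normalize[OF p that] eval_rev_map_upt[of "Suc d" c x] that c
    by (simp add: p_def less_Suc_eq_le lessThan_Suc_atMost del: upt_Suc)
  moreover have "finite {x. is_root (normalize p) x}"
    using normalize_gives_polynomial[OF p] by (intro finite_number_of_roots) (simp add: univ_poly_carrier)
  ultimately show ?thesis
    by (elim rev_finite_subset) (auto simp: is_root_def)
qed

section \<open>The series ring is a domain\<close>

text \<open>
  As long as some coordinate is not constant on both sets, both can be replaced by their faces on
  which this coordinate is least: a sum of two points of the faces is minimal in this coordinate, so
  it has no representation that leaves the faces.  Once every coordinate is constant, both sets are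
  singletons.  This finds the summands that a lexicographic order would call least, with no order on
  the index type.
\<close>

lemma unique_sum_representation:
  fixes S T :: "('b::linordered_ab_group_add ^ 'n::finite) set"
  assumes "finite S" "S \<noteq> {}" "finite T" "T \<noteq> {}"
  shows "\<exists>s\<in>S. \<exists>t\<in>T. \<forall>s'\<in>S. \<forall>t'\<in>T. s' + t' = s + t \<longrightarrow> s' = s \<and> t' = t"
  using assms
proof (induction "card S + card T" arbitrary: S T rule: less_induct)
  case less
  show ?case
  proof (cases "\<exists>i. (\<exists>s\<in>S. \<exists>s'\<in>S. s $ i \<noteq> s' $ i) \<or> (\<exists>t\<in>T. \<exists>t'\<in>T. t $ i \<noteq> t' $ i)")
    case True
    then obtain i where i: "(\<exists>s\<in>S. \<exists>s'\<in>S. s $ i \<noteq> s' $ i) \<or> (\<exists>t\<in>T. \<exists>t'\<in>T. t $ i \<noteq> t' $ i)"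
      by blast
    define low :: "('b ^ 'n) set \<Rightarrow> ('b ^ 'n) set"
      where "low U = {u \<in> U. u $ i = Min ((\<lambda>u. u $ i) ` U)}" for U
    have low_nonempty: "low U \<noteq> {}" and least: "\<And>u v. u \<in> low U \<Longrightarrow> v \<in> U \<Longrightarrow> u $ i \<le> v $ i"
      if "finite U" "U \<noteq> {}" for U
    proof -
      have "Min ((\<lambda>u. u $ i) ` U) \<in> (\<lambda>u. u $ i) ` U"
        using that by (intro Min_in) auto
      then show "low U \<noteq> {}"
        by (auto simp: low_def)
      show "u $ i \<le> v $ i" if "u \<in> low U" "v \<in> U" for u v
        using that \<open>finite U\<close> by (auto simp: low_def)
    qed
    have low_subset: "low U \<subseteq> U" for U
      by (auto simp: low_def)
    have "low U \<noteq> U" if "s \<in> U" "s' \<in> U" "s $ i \<noteq> s' $ i" for s s' U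
      using that by (metis (mono_tags, lifting) low_def mem_Collect_eq)
    then have "low S \<subset> S \<or> low T \<subset> T"
      using i low_subset by blast
    then have "card (low S) + card (low T) < card S + card T"
    proof
      assume "low S \<subset> S"
      then show ?thesis
        using less.prems card_mono[OF _ low_subset[of T]] by (intro add_less_le_mono psubset_card_mono)
    next
      assume "low T \<subset> T"
      then show ?thesis
        using less.prems card_mono[OF _ low_subset[of S]] by (intro add_le_less_mono psubset_card_mono)
    qed
    then obtain s t where st: "s \<in> low S" "t \<in> low T"
      and unique: "\<And>s' t'. s' \<in> low S \<Longrightarrow> t' \<in> low T \<Longrightarrow> s' + t' = s + t \<Longrightarrow> s' = s \<and> t' = t"
      using less.hyps[of "low S" "low T"] less.prems low_nonempty finite_subset[OF low_subset]
      by blast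
    have "s' = s \<and> t' = t" if "s' \<in> S" "t' \<in> T" and eq: "s' + t' = s + t" for s' t'
    proof (rule unique)
      have "s $ i \<le> s' $ i" "t $ i \<le> t' $ i"
        using least st that less.prems by blast+
      moreover have "s' $ i + t' $ i = s $ i + t $ i"
        using eq by (metis vector_add_component)
      ultimately have "s' $ i = s $ i" "t' $ i = t $ i"
        using add_less_le_mono[of "s $ i" "s' $ i" "t $ i" "t' $ i"]
          add_le_less_mono[of "s $ i" "s' $ i" "t $ i" "t' $ i"] by (auto simp: order_le_less)
      then show "s' \<in> low S" "t' \<in> low T"
        using st that by (auto simp: low_def)
    qed (rule eq)
    then show ?thesis
      using st low_subset by blast
  next
    case False
    then have coordinates: "\<And>s s' i. s \<in> S \<Longrightarrow> s' \<in> S \<Longrightarrow> s' $ i = s $ i"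
      "\<And>t t' i. t \<in> T \<Longrightarrow> t' \<in> T \<Longrightarrow> t' $ i = t $ i"
      by metis+
    obtain s t where st: "s \<in> S" "t \<in> T"
      using less.prems by blast
    have "s' = s \<and> t' = t" if "s' \<in> S" "t' \<in> T" for s' t'
      unfolding vec_eq_iff using coordinates(1)[OF st(1) that(1)] coordinates(2)[OF st(2) that(2)] by simp
    then show ?thesis
      by (intro bexI[OF _ st(1)] bexI[OF _ st(2)] ballI impI)
  qed
qed

locale graded_monoid =
  fixes M :: "(int ^ 'm::finite) set" and deg :: "int ^ 'm \<Rightarrow> nat"
  assumes zero_mem: "0 \<in> M"
    and add_mem: "\<And>\<kappa> \<mu>. \<kappa> \<in> M \<Longrightarrow> \<mu> \<in> M \<Longrightarrow> \<kappa> + \<mu> \<in> M"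
    and deg_add: "\<And>\<kappa> \<mu>. \<kappa> \<in> M \<Longrightarrow> \<mu> \<in> M \<Longrightarrow> deg (\<kappa> + \<mu>) = deg \<kappa> + deg \<mu>"
    and finite_deg_le: "\<And>d::real. finite {\<kappa> \<in> M. real (deg \<kappa>) \<le> d}"
begin

text \<open>
  The support of a series may be infinite, but its part of least degree is finite; this is what makes
  \<open>unique_sum_representation\<close> applicable to series.
\<close>

lemma finite_least_degree_support:
  fixes f :: "int ^ 'm \<Rightarrow> 'r::idom"
  assumes "f \<in> carrier (monoid_series M)" "f \<noteq> \<zero>\<^bsub>monoid_series M\<^esub>"
  obtains n where "finite {\<kappa>. f \<kappa> \<noteq> 0 \<and> deg \<kappa> = n}" "{\<kappa>. f \<kappa> \<noteq> 0 \<and> deg \<kappa> = n} \<noteq> {}"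
    "\<And>\<kappa>. f \<kappa> \<noteq> 0 \<Longrightarrow> n \<le> deg \<kappa>"
proof
  define n where "n = (LEAST n. \<exists>\<kappa>. f \<kappa> \<noteq> 0 \<and> deg \<kappa> = n)"
  obtain \<kappa>\<^sub>0 where \<kappa>\<^sub>0: "f \<kappa>\<^sub>0 \<noteq> 0"
    using assms by (auto simp: monoid_series_def)
  show "{\<kappa>. f \<kappa> \<noteq> 0 \<and> deg \<kappa> = n} \<noteq> {}"
    using LeastI_ex[of "\<lambda>n. \<exists>\<kappa>. f \<kappa> \<noteq> 0 \<and> deg \<kappa> = n"] \<kappa>\<^sub>0 by (auto simp: n_def)
  show "n \<le> deg \<kappa>" if "f \<kappa> \<noteq> 0" for \<kappa>
    unfolding n_def using that by (intro Least_le) blast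
  show "finite {\<kappa>. f \<kappa> \<noteq> 0 \<and> deg \<kappa> = n}"
    using assms by (intro finite_subset[OF _ finite_deg_le[of "real n"]]) (auto simp: monoid_series_def)
qed

text \<open>
  Among the summands of least degree of two nonzero series there is a pair whose sum is attained only
  once.  Its coefficient in the product is then a single product of nonzero elements of \<open>R\<close>.
\<close>

lemma domain_monoid_series: "domain (monoid_series M :: (int ^ 'm \<Rightarrow> 'r::idom) ring)"
proof -
  let ?S = "monoid_series M :: (int ^ 'm \<Rightarrow> 'r) ring"
  interpret cring ?S
    by (rule cring_monoid_series[OF zero_mem add_mem deg_add finite_deg_le])
  show ?thesis
  proof
    show "\<one>\<^bsub>?S\<^esub> \<noteq> \<zero>\<^bsub>?S\<^esub>"
      by (auto simp: monoid_series_def dest: fun_cong[of _ _ 0])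
  next
    fix f g
    assume fg: "f \<otimes>\<^bsub>?S\<^esub> g = \<zero>\<^bsub>?S\<^esub>" "f \<in> carrier ?S" "g \<in> carrier ?S"
    show "f = \<zero>\<^bsub>?S\<^esub> \<or> g = \<zero>\<^bsub>?S\<^esub>"
    proof (rule ccontr)
      assume "\<not> ?thesis"
      then have nonzero: "f \<noteq> \<zero>\<^bsub>?S\<^esub>" "g \<noteq> \<zero>\<^bsub>?S\<^esub>"
        by auto
      obtain m where m: "finite {\<kappa>. f \<kappa> \<noteq> 0 \<and> deg \<kappa> = m}" "{\<kappa>. f \<kappa> \<noteq> 0 \<and> deg \<kappa> = m} \<noteq> {}"
        "\<And>\<kappa>. f \<kappa> \<noteq> 0 \<Longrightarrow> m \<le> deg \<kappa>"
        by (rule finite_least_degree_support[OF fg(2) nonzero(1)]) (rule that)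
      obtain n where n: "finite {\<kappa>. g \<kappa> \<noteq> 0 \<and> deg \<kappa> = n}" "{\<kappa>. g \<kappa> \<noteq> 0 \<and> deg \<kappa> = n} \<noteq> {}"
        "\<And>\<kappa>. g \<kappa> \<noteq> 0 \<Longrightarrow> n \<le> deg \<kappa>"
        by (rule finite_least_degree_support[OF fg(3) nonzero(2)]) (rule that)
      obtain \<kappa> \<mu> where \<kappa>: "f \<kappa> \<noteq> 0" "deg \<kappa> = m" and \<mu>: "g \<mu> \<noteq> 0" "deg \<mu> = n"
        and unique: "\<And>\<kappa>' \<mu>'. f \<kappa>' \<noteq> 0 \<Longrightarrow> deg \<kappa>' = m \<Longrightarrow> g \<mu>' \<noteq> 0 \<Longrightarrow> deg \<mu>' = n \<Longrightarrow>
          \<kappa>' + \<mu>' = \<kappa> + \<mu> \<Longrightarrow> \<kappa>' = \<kappa> \<and> \<mu>' = \<mu>"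
        using unique_sum_representation[OF m(1,2) n(1,2)] by blast
      have mem: "\<kappa> \<in> M" "\<mu> \<in> M"
        using fg \<kappa> \<mu> by (auto simp: monoid_series_def)
      have off: "f \<kappa>' * g \<mu>' = 0"
        if "(\<kappa>', \<mu>') \<in> series_splits M (\<kappa> + \<mu>) - {(\<kappa>, \<mu>)}" for \<kappa>' \<mu>'
      proof (rule ccontr)
        assume "\<not> ?thesis"
        then have nz: "f \<kappa>' \<noteq> 0" "g \<mu>' \<noteq> 0"
          by auto
        have split: "\<kappa>' \<in> M" "\<mu>' \<in> M" "\<kappa>' + \<mu>' = \<kappa> + \<mu>"
          using that by (auto simp: series_splits_def)
        \<comment> \<open>The degrees add up to the least possible value, so each of them is least.\<close>
        then have "deg \<kappa>' + deg \<mu>' = m + n"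
          using deg_add mem \<kappa> \<mu> by metis
        then have "deg \<kappa>' = m" "deg \<mu>' = n"
          using m(3)[OF nz(1)] n(3)[OF nz(2)] by auto
        then show False
          using unique[OF nz(1) _ nz(2)] split that by auto
      qed
      have "(\<Sum>(\<kappa>', \<mu>')\<in>series_splits M (\<kappa> + \<mu>). f \<kappa>' * g \<mu>') =
          (\<Sum>(\<kappa>', \<mu>')\<in>{(\<kappa>, \<mu>)}. f \<kappa>' * g \<mu>')"
      proof (intro sum.mono_neutral_right ballI)
        show "finite (series_splits M (\<kappa> + \<mu>))"
          by (rule finite_series_splits[OF deg_add finite_deg_le])
        show "{(\<kappa>, \<mu>)} \<subseteq> series_splits M (\<kappa> + \<mu>)"
          using mem by (auto simp: series_splits_def)
        show "(case p of (\<kappa>', \<mu>') \<Rightarrow> f \<kappa>' * g \<mu>') = 0"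
          if "p \<in> series_splits M (\<kappa> + \<mu>) - {(\<kappa>, \<mu>)}" for p
          using that off[of "fst p" "snd p"] by (simp only: prod.collapse case_prod_unfold)
      qed
      then have "(f \<otimes>\<^bsub>?S\<^esub> g) (\<kappa> + \<mu>) = f \<kappa> * g \<mu>"
        by (simp add: monoid_series_def)
      moreover have "(f \<otimes>\<^bsub>?S\<^esub> g) (\<kappa> + \<mu>) = 0"
        unfolding fg(1) by (simp add: monoid_series_def)
      ultimately show False
        using \<kappa> \<mu> by simp
    qed
  qed
qed

end

section \<open>Slices along a linear functional\<close>

definition slice :: "('b \<Rightarrow> real) \<Rightarrow> real \<Rightarrow> ('b \<Rightarrow> 'r::zero) \<Rightarrow> 'b \<Rightarrow> 'r" where
  "slice \<delta> v g = (\<lambda>\<kappa>. if \<delta> \<kappa> = v then g \<kappa> else 0)"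

definition supported_above :: "('b \<Rightarrow> real) \<Rightarrow> real \<Rightarrow> ('b \<Rightarrow> 'r::zero) \<Rightarrow> bool" where
  "supported_above \<delta> v g \<longleftrightarrow> (\<forall>\<kappa>. g \<kappa> \<noteq> 0 \<longrightarrow> v \<le> \<delta> \<kappa>)"

lemma slice_closed: "g \<in> carrier (monoid_series M) \<Longrightarrow> slice \<delta> v g \<in> carrier (monoid_series M)"
  by (auto simp: monoid_series_def slice_def)

text \<open>
  In a product of two monomials of weights at least \<open>u\<close> and \<open>v\<close>, the weight \<open>u + v\<close> occurs only when
  both bounds are attained.  Hence passing to the lowest parts is multiplicative.
\<close>

lemma slice_mult:
  fixes g h :: "int ^ 'm::finite \<Rightarrow> 'r::idom"
  assumes \<delta>: "additive \<delta>" and g: "supported_above \<delta> u g" and h: "supported_above \<delta> v h"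
  shows "slice \<delta> (u + v) (g \<otimes>\<^bsub>monoid_series M\<^esub> h) =
    slice \<delta> u g \<otimes>\<^bsub>monoid_series M\<^esub> slice \<delta> v h"
proof
  fix \<nu>
  have "(if \<delta> \<nu> = u + v then g \<kappa> * h \<mu> else 0) = slice \<delta> u g \<kappa> * slice \<delta> v h \<mu>"
    if "(\<kappa>, \<mu>) \<in> series_splits M \<nu>" for \<kappa> \<mu>
  proof -
    have "\<delta> \<nu> = \<delta> \<kappa> + \<delta> \<mu>"
      using that additive.add[OF \<delta>] by (auto simp: series_splits_def)
    moreover have "g \<kappa> = 0 \<or> u \<le> \<delta> \<kappa>" "h \<mu> = 0 \<or> v \<le> \<delta> \<mu>"
      using g h by (auto simp: supported_above_def)
    ultimately show ?thesis
      by (auto simp: slice_def)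
  qed
  then have "(\<Sum>(\<kappa>, \<mu>)\<in>series_splits M \<nu>. if \<delta> \<nu> = u + v then g \<kappa> * h \<mu> else 0) =
      (\<Sum>(\<kappa>, \<mu>)\<in>series_splits M \<nu>. slice \<delta> u g \<kappa> * slice \<delta> v h \<mu>)"
    by (intro sum.cong) auto
  then show "slice \<delta> (u + v) (g \<otimes>\<^bsub>monoid_series M\<^esub> h) \<nu> =
      (slice \<delta> u g \<otimes>\<^bsub>monoid_series M\<^esub> slice \<delta> v h) \<nu>"
    by (cases "\<delta> \<nu> = u + v") (auto simp: monoid_series_def slice_def[of \<delta> "u + v"])
qed

lemma supported_above_mult:
  fixes g h :: "int ^ 'm::finite \<Rightarrow> 'r::idom"
  assumes \<delta>: "additive \<delta>" and g: "supported_above \<delta> u g" and h: "supported_above \<delta> v h"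
  shows "supported_above \<delta> (u + v) (g \<otimes>\<^bsub>monoid_series M\<^esub> h)"
  unfolding supported_above_def
proof (intro allI impI)
  fix \<nu> assume "(g \<otimes>\<^bsub>monoid_series M\<^esub> h) \<nu> \<noteq> 0"
  then have "(\<Sum>(\<kappa>, \<mu>)\<in>series_splits M \<nu>. g \<kappa> * h \<mu>) \<noteq> 0"
    by (simp add: monoid_series_def)
  then obtain p where "p \<in> series_splits M \<nu>" "(case p of (\<kappa>, \<mu>) \<Rightarrow> g \<kappa> * h \<mu>) \<noteq> 0"
    by (rule sum.not_neutral_contains_not_neutral)
  then obtain \<kappa> \<mu> where "\<nu> = \<kappa> + \<mu>" "g \<kappa> \<noteq> 0" "h \<mu> \<noteq> 0"
    by (auto simp: series_splits_def)
  then show "u + v \<le> \<delta> \<nu>"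
    using g h additive.add[OF \<delta>] by (auto simp: supported_above_def intro: add_mono)
qed

context graded_monoid
begin

lemma slice_pow:
  fixes g :: "int ^ 'm \<Rightarrow> 'r::idom" and n :: nat
  assumes \<delta>: "additive \<delta>" and g: "supported_above \<delta> u g"
  shows "slice \<delta> (real n * u) (g [^]\<^bsub>monoid_series M\<^esub> n) = slice \<delta> u g [^]\<^bsub>monoid_series M\<^esub> n
    \<and> supported_above \<delta> (real n * u) (g [^]\<^bsub>monoid_series M\<^esub> n)"
proof -
  let ?S = "monoid_series M :: (int ^ 'm \<Rightarrow> 'r) ring"
  interpret domain ?S
    by (rule domain_monoid_series)
  show ?thesis
  proof (induction n)
    case 0
    have "\<delta> 0 = 0"
      by (rule additive.zero[OF \<delta>])
    then show ?case
      by (auto simp: monoid_series_def nat_pow_def slice_def supported_above_def)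
  next
    case (Suc n)
    have "real (Suc n) * u = real n * u + u"
      by (simp add: algebra_simps)
    then show ?case
      using Suc slice_mult[OF \<delta> _ g] supported_above_mult[OF \<delta> _ g] by auto
  qed
qed

lemma slice_finsum:
  fixes g :: "'i \<Rightarrow> int ^ 'm \<Rightarrow> 'r::idom"
  assumes "finite I" "\<And>i. i \<in> I \<Longrightarrow> g i \<in> carrier (monoid_series M)"
  shows "slice \<delta> v (\<Oplus>\<^bsub>monoid_series M\<^esub>i\<in>I. g i) = (\<Oplus>\<^bsub>monoid_series M\<^esub>i\<in>I. slice \<delta> v (g i))"
proof -
  let ?S = "monoid_series M :: (int ^ 'm \<Rightarrow> 'r) ring"
  interpret domain ?S
    by (rule domain_monoid_series)
  have zero: "slice \<delta> v \<zero>\<^bsub>?S\<^esub> = \<zero>\<^bsub>?S\<^esub>"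
    by (auto simp: monoid_series_def slice_def)
  have add: "slice \<delta> v (p \<oplus>\<^bsub>?S\<^esub> q) = slice \<delta> v p \<oplus>\<^bsub>?S\<^esub> slice \<delta> v q" for p q
    by (auto simp: monoid_series_def slice_def)
  show ?thesis
    using assms by (induction rule: finite_induct) (auto simp: zero add slice_closed Pi_def)
qed

text \<open>
  The weight \<open>v\<close> is the least weight that some \<open>b i \<otimes> f [^] i\<close> can have, judged by the support of
  \<open>b i\<close> and the bound \<open>u\<close> for \<open>f\<close>.  Taking the slice of the relation at \<open>v\<close> cuts \<open>b i\<close> at weight
  \<open>w i = v - i * u\<close>.  A coefficient that attains the minimum \<open>v\<close> keeps a nonzero slice.
\<close>

lemma slice_is_root:
  fixes f :: "int ^ 'm \<Rightarrow> 'r::idom" and b :: "nat \<Rightarrow> int ^ 'm \<Rightarrow> 'r"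
  assumes \<delta>: "additive \<delta>"
    and f: "f \<in> carrier (monoid_series M)" "supported_above \<delta> u f"
    and b: "\<And>i. i \<le> d \<Longrightarrow> b i \<in> monoid_polys M" "\<exists>i\<le>d. b i \<noteq> \<zero>\<^bsub>monoid_series M\<^esub>"
    and relation: "(\<Oplus>\<^bsub>monoid_series M\<^esub>i\<in>{..d}. b i \<otimes>\<^bsub>monoid_series M\<^esub> f [^]\<^bsub>monoid_series M\<^esub> i)
      = \<zero>\<^bsub>monoid_series M\<^esub>"
  obtains w where "\<exists>i\<le>d. slice \<delta> (w i) (b i) \<noteq> \<zero>\<^bsub>monoid_series M\<^esub>"
    and "(\<Oplus>\<^bsub>monoid_series M\<^esub>i\<in>{..d}. slice \<delta> (w i) (b i) \<otimes>\<^bsub>monoid_series M\<^esub>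
      slice \<delta> u f [^]\<^bsub>monoid_series M\<^esub> i) = \<zero>\<^bsub>monoid_series M\<^esub>"
proof -
  let ?S = "monoid_series M :: (int ^ 'm \<Rightarrow> 'r) ring"
  interpret domain ?S
    by (rule domain_monoid_series)
  define V where "V = (\<Union>i\<le>d. (\<lambda>\<kappa>. \<delta> \<kappa> + real i * u) ` {\<kappa>. b i \<kappa> \<noteq> 0})"
  define v where "v = Min V"
  define w where "w i = v - real i * u" for i
  have closed: "b i \<in> carrier ?S" if "i \<le> d" for i
    using b(1)[OF that] by (simp add: monoid_polys_def)
  have "finite V"
    using b(1) by (auto simp: V_def monoid_polys_def)
  moreover have "V \<noteq> {}"
    using b(2) by (auto simp: V_def monoid_series_def fun_eq_iff)
  ultimately have "v \<in> V" and least: "\<And>x. x \<in> V \<Longrightarrow> v \<le> x"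
    by (auto simp: v_def)
  show thesis
  proof
    obtain i \<kappa> where "i \<le> d" "b i \<kappa> \<noteq> 0" "v = \<delta> \<kappa> + real i * u"
      using \<open>v \<in> V\<close> by (auto simp: V_def)
    then have "slice \<delta> (w i) (b i) \<kappa> \<noteq> 0"
      by (simp add: slice_def w_def)
    then have "slice \<delta> (w i) (b i) \<noteq> \<zero>\<^bsub>?S\<^esub>"
      by (auto simp: monoid_series_def)
    then show "\<exists>i\<le>d. slice \<delta> (w i) (b i) \<noteq> \<zero>\<^bsub>?S\<^esub>"
      using \<open>i \<le> d\<close> by blast
    have "slice \<delta> v (b i \<otimes>\<^bsub>?S\<^esub> f [^]\<^bsub>?S\<^esub> i) = slice \<delta> (w i) (b i) \<otimes>\<^bsub>?S\<^esub> slice \<delta> u f [^]\<^bsub>?S\<^esub> i"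
      if "i \<le> d" for i
    proof -
      have "supported_above \<delta> (w i) (b i)"
        unfolding supported_above_def
      proof (intro allI impI)
        fix \<kappa> assume "b i \<kappa> \<noteq> 0"
        then have "v \<le> \<delta> \<kappa> + real i * u"
          using that by (intro least) (auto simp: V_def)
        then show "w i \<le> \<delta> \<kappa>"
          by (simp add: w_def)
      qed
      then show ?thesis
        using slice_mult[OF \<delta> _ conjunct2[OF slice_pow[OF \<delta> f(2)]], of "w i" "b i" i M]
          conjunct1[OF slice_pow[OF \<delta> f(2)], of i] by (simp add: w_def)
    qed
    then have "(\<Oplus>\<^bsub>?S\<^esub>i\<in>{..d}. slice \<delta> (w i) (b i) \<otimes>\<^bsub>?S\<^esub> slice \<delta> u f [^]\<^bsub>?S\<^esub> i) =
        (\<Oplus>\<^bsub>?S\<^esub>i\<in>{..d}. slice \<delta> v (b i \<otimes>\<^bsub>?S\<^esub> f [^]\<^bsub>?S\<^esub> i))"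
      using closed f(1) by (intro finsum_cong') (auto simp: slice_closed)
    also have "\<dots> = slice \<delta> v \<zero>\<^bsub>?S\<^esub>"
      using closed f(1) by (subst slice_finsum[symmetric]) (auto simp: relation)
    also have "\<dots> = \<zero>\<^bsub>?S\<^esub>"
      by (auto simp: monoid_series_def slice_def)
    finally show "(\<Oplus>\<^bsub>?S\<^esub>i\<in>{..d}. slice \<delta> (w i) (b i) \<otimes>\<^bsub>?S\<^esub> slice \<delta> u f [^]\<^bsub>?S\<^esub> i) = \<zero>\<^bsub>?S\<^esub>" .
  qed
qed

text \<open>
  Each lowest slice of \<open>f\<close> is a root of a nonzero polynomial whose coefficients are restrictions of
  the coefficients \<open>b i\<close> to subsets of their finite supports.  These finitely many polynomials do not
  depend on \<open>\<delta>\<close> and \<open>u\<close>, and each has finitely many roots.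
\<close>

lemma finite_lowest_slices_of_algebraic:
  fixes f :: "int ^ 'm \<Rightarrow> 'r::idom"
  assumes "algebraic_series M f"
  shows "finite {slice \<delta> u f | \<delta> u. additive \<delta> \<and> supported_above \<delta> u f}"
proof -
  let ?S = "monoid_series M :: (int ^ 'm \<Rightarrow> 'r) ring"
  interpret domain ?S
    by (rule domain_monoid_series)
  obtain d :: nat and b where f: "f \<in> carrier ?S"
    and b: "\<And>i. i \<le> d \<Longrightarrow> b i \<in> monoid_polys M" "\<exists>i\<le>d. b i \<noteq> \<zero>\<^bsub>?S\<^esub>"
    and relation: "(\<Oplus>\<^bsub>?S\<^esub>i\<in>{..d}. b i \<otimes>\<^bsub>?S\<^esub> f [^]\<^bsub>?S\<^esub> i) = \<zero>\<^bsub>?S\<^esub>"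
    using assms unfolding algebraic_series_def by blast
  define restrictions where
    "restrictions i = (\<lambda>U \<kappa>. if \<kappa> \<in> U then b i \<kappa> else 0) ` Pow {\<kappa>. b i \<kappa> \<noteq> 0}" for i
  define C where "C = {c \<in> Pi\<^sub>E {..d} restrictions. \<exists>i\<le>d. c i \<noteq> \<zero>\<^bsub>?S\<^esub>}"
  have restrictions_closed: "restrictions i \<subseteq> carrier ?S" if "i \<le> d" for i
    using b(1)[OF that] by (auto simp: restrictions_def monoid_polys_def monoid_series_def)
  have "finite (Pi\<^sub>E {..d} restrictions)"
    using b(1) by (intro finite_PiE) (auto simp: restrictions_def monoid_polys_def)
  then have "finite C"
    by (simp add: C_def)
  moreover have "finite {x \<in> carrier ?S. (\<Oplus>\<^bsub>?S\<^esub>i\<in>{..d}. c i \<otimes>\<^bsub>?S\<^esub> x [^]\<^bsub>?S\<^esub> i) = \<zero>\<^bsub>?S\<^esub>}"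
    if "c \<in> C" for c
    using that restrictions_closed by (intro finite_roots_of_power_sum) (auto simp: C_def)
  ultimately have "finite (\<Union>c\<in>C. {x \<in> carrier ?S. (\<Oplus>\<^bsub>?S\<^esub>i\<in>{..d}. c i \<otimes>\<^bsub>?S\<^esub> x [^]\<^bsub>?S\<^esub> i) = \<zero>\<^bsub>?S\<^esub>})"
    by blast
  then show ?thesis
  proof (rule rev_finite_subset, safe)
    fix \<delta> u assume \<delta>: "additive \<delta>" and u: "supported_above \<delta> u f"
    obtain w where w: "\<exists>i\<le>d. slice \<delta> (w i) (b i) \<noteq> \<zero>\<^bsub>?S\<^esub>"
      "(\<Oplus>\<^bsub>?S\<^esub>i\<in>{..d}. slice \<delta> (w i) (b i) \<otimes>\<^bsub>?S\<^esub> slice \<delta> u f [^]\<^bsub>?S\<^esub> i) = \<zero>\<^bsub>?S\<^esub>"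
      by (rule slice_is_root[OF \<delta> f u b relation])
    let ?c = "\<lambda>i\<in>{..d}. slice \<delta> (w i) (b i)"
    have "slice \<delta> (w i) (b i) \<in> restrictions i" for i
      unfolding restrictions_def
      by (rule image_eqI[of _ _ "{\<kappa>. b i \<kappa> \<noteq> 0 \<and> \<delta> \<kappa> = w i}"]) (auto simp: slice_def)
    then have "?c \<in> C"
      using w(1) by (auto simp: C_def)
    moreover have "(\<Oplus>\<^bsub>?S\<^esub>i\<in>{..d}. ?c i \<otimes>\<^bsub>?S\<^esub> slice \<delta> u f [^]\<^bsub>?S\<^esub> i) =
        (\<Oplus>\<^bsub>?S\<^esub>i\<in>{..d}. slice \<delta> (w i) (b i) \<otimes>\<^bsub>?S\<^esub> slice \<delta> u f [^]\<^bsub>?S\<^esub> i)"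
      using b(1) f by (intro finsum_cong') (auto simp: slice_closed monoid_polys_def)
    moreover have "slice \<delta> u f \<in> carrier ?S"
      using f by (rule slice_closed)
    ultimately show "slice \<delta> u f \<in>
        (\<Union>c\<in>C. {x \<in> carrier ?S. (\<Oplus>\<^bsub>?S\<^esub>i\<in>{..d}. c i \<otimes>\<^bsub>?S\<^esub> x [^]\<^bsub>?S\<^esub> i) = \<zero>\<^bsub>?S\<^esub>})"
      using w(2) by (intro UN_I[of ?c] CollectI conjI) simp_all
  qed
qed

end

section \<open>Transcendence\<close>

theorem proposition4p1:
  fixes M J :: "(int ^ 'm::finite) set"
    and deg :: "int ^ 'm \<Rightarrow> nat"
    and A :: "'a set"
    and \<delta> :: "'a \<Rightarrow> int ^ 'm \<Rightarrow> real"
    and \<epsilon> :: "'a \<Rightarrow> real"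
    and a :: "int ^ 'm \<Rightarrow> 'r::idom"
  assumes M_zero: "0 \<in> M"
    and M_add: "\<And>\<kappa> \<mu>. \<kappa> \<in> M \<Longrightarrow> \<mu> \<in> M \<Longrightarrow> \<kappa> + \<mu> \<in> M"
    and deg_zero: "deg 0 = 0"
    and deg_add: "\<And>\<kappa> \<mu>. \<kappa> \<in> M \<Longrightarrow> \<mu> \<in> M \<Longrightarrow> deg (\<kappa> + \<mu>) = deg \<kappa> + deg \<mu>"
    and deg_finite: "\<And>d::real. finite {\<kappa> \<in> M. real (deg \<kappa>) \<le> d}"
    and J_subset: "J \<subseteq> M"
    and \<delta>_linear: "\<And>\<alpha>. \<alpha> \<in> A \<Longrightarrow> additive (\<delta> \<alpha>)"
    and \<epsilon>_attained: "\<And>\<alpha>. \<alpha> \<in> A \<Longrightarrow> \<exists>D\<in>J. \<delta> \<alpha> D = \<epsilon> \<alpha>"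
    and \<epsilon>_least: "\<And>\<alpha> D. \<alpha> \<in> A \<Longrightarrow> D \<in> J \<Longrightarrow> \<epsilon> \<alpha> \<le> \<delta> \<alpha> D"
    and \<epsilon>_nonneg: "\<And>\<alpha>. \<alpha> \<in> A \<Longrightarrow> \<epsilon> \<alpha> \<ge> 0"
    and infinite_faces: "infinite ((\<lambda>\<alpha>. {D \<in> J. \<delta> \<alpha> D = \<epsilon> \<alpha>}) ` A)"
    and a_nonzero: "\<And>D. D \<in> J \<Longrightarrow> a D \<noteq> 0"
  shows "transcendental_series M (\<lambda>D. if D \<in> J then a D else 0)"
proof -
  interpret graded_monoid M deg
    by unfold_locales (fact M_zero M_add deg_add deg_finite)+
  define f where "f = (\<lambda>D. if D \<in> J then a D else 0)"
  have f_nonzero: "f D \<noteq> 0 \<longleftrightarrow> D \<in> J" for D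
    using a_nonzero by (auto simp: f_def)
  have "\<not> algebraic_series M f"
  proof
    assume "algebraic_series M f"
    then have "finite {slice \<delta> u f | \<delta> u. additive \<delta> \<and> supported_above \<delta> u f}"
      by (rule finite_lowest_slices_of_algebraic)
    moreover have "(\<lambda>\<alpha>. slice (\<delta> \<alpha>) (\<epsilon> \<alpha>) f) ` A \<subseteq> {slice \<delta> u f | \<delta> u. additive \<delta> \<and> supported_above \<delta> u f}"
    proof (intro image_subsetI CollectI exI conjI)
      show "supported_above (\<delta> \<alpha>) (\<epsilon> \<alpha>) f" if "\<alpha> \<in> A" for \<alpha>
        using \<epsilon>_least that by (auto simp: supported_above_def f_nonzero)
    qed (auto intro: \<delta>_linear)
    ultimately have "finite ((\<lambda>\<alpha>. slice (\<delta> \<alpha>) (\<epsilon> \<alpha>) f) ` A)"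
      by (rule rev_finite_subset)
    \<comment> \<open>The face can be read off from the slice as its support.\<close>
    then have "finite ((\<lambda>g. {D. g D \<noteq> 0}) ` (\<lambda>\<alpha>. slice (\<delta> \<alpha>) (\<epsilon> \<alpha>) f) ` A)"
      by (rule finite_imageI)
    moreover have "{D. slice (\<delta> \<alpha>) (\<epsilon> \<alpha>) f D \<noteq> 0} = {D \<in> J. \<delta> \<alpha> D = \<epsilon> \<alpha>}" for \<alpha>
      using f_nonzero by (auto simp: slice_def)
    ultimately show False
      using infinite_faces by (simp add: image_image)
  qed
  moreover have "f \<in> carrier (monoid_series M)"
    using J_subset by (auto simp: monoid_series_def f_def)
  ultimately show ?thesis
    by (simp add: transcendental_series_def f_def)
qed

end
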